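(* For every polynomial $P\in\mathbb{H}[X]$ of degree $\ge 2$, $$V(P')\subset\mathfrak{sn}(P),$$ where $\mathfrak{sn}(P)$ is the Gauss-Lucas snail of $P$.
   Context: $\mathbb{H}$ denotes the real algebra of quaternions. $\mathbb{H}[X]$ is the set of quaternionic polynomials $P(X)=\sum_{k=0}^d X^k a_k$ with coefficients $a_k\in\mathbb{H}$ written on the right. The value of $P$ at $x\in\mathbb{H}$ is $P(x)=\sum_{k=0}^d x^k a_k$, and $V(P)=\{x\in\mathbb{H}\mid P(x)=0\}$. The derivative is $P'(X)=\sum_{k=1}^d X^{k-1}k a_k$. $\mathbb{S}=\{I\in\mathbb{H}\mid I^2=-1\}$ is the 2-sphere of imaginary units, and for $I\in\mathbb{S}$, $\mathbb{C}_I\subset\mathbb{H}$ is the real plane spanned by $1$ and $I$ (a copy of $\mathbb{C}$). For $Q\in\mathbb{H}[X]$, let $Q_I:\mathbb{C}_I\to\mathbb{H}$ be the restriction of the function $x\mapsto Q(x)$ to $\mathbb{C}_I$. If $Q_I$ is not constant, $\mathcal{K}_{\mathbb{C}_I}(Q)$ denotes the convex hull in $\mathbb{C}_I$ of $V(Q)\cap\mathbb{C}_I$; if $Q_I$ is constant, set $\mathcal{K}_{\mathbb{C}_I}(Q)=\mathbb{C}_I$. Let $\pi_I:\mathbb{H}\to\mathbb{H}$ be the orthogonal projection onto $\mathbb{C}_I$ (with respect to the Euclidean structure of $\mathbb{H}\cong\mathbb{R}^4$). For $P(X)=\sum_{k=0}^d X^k a_k$ of degree $d\ge2$ and $I\in\mathbb{S}$,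 let $P^I(X)=\sum_{k=0}^d X^k\pi_I(a_k)$. The Gauss-Lucas snail of $P$ is $$\mathfrak{sn}(P)=\bigcup_{I\in\mathbb{S}}\mathcal{K}_{\mathbb{C}_I}(P^I)\subset\mathbb{H}.$$ *)

theory Defs
  imports "HOL-Analysis.Analysis" "HOL-Computational_Algebra.Polynomial"
begin

section \<open>Quaternions\<close>

text \<open>
  \<open>Quat a b c d\<close> stands for $a + bi + cj + dk$. As in \<^theory>\<open>HOL.Complex\<close>,
  \<open>codatatype\<close> is used only in order to define the operations componentwise by \<open>primcorec\<close>.
\<close>

codatatype quat = Quat (qr: real) (qi: real) (qj: real) (qk: real)

lemma quat_eq_iff: "x = y \<longleftrightarrow> qr x = qr y \<and> qi x = qi y \<and> qj x = qj y \<and> qk x = qk y"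
  by (auto intro: quat.expand)

instantiation quat :: ab_group_add
begin

primcorec zero_quat where
  "qr 0 = 0" | "qi 0 = 0" | "qj 0 = 0" | "qk 0 = 0"

primcorec plus_quat where
  "qr (x + y) = qr x + qr y"
| "qi (x + y) = qi x + qi y"
| "qj (x + y) = qj x + qj y"
| "qk (x + y) = qk x + qk y"

primcorec uminus_quat where
  "qr (- x) = - qr x"
| "qi (- x) = - qi x"
| "qj (- x) = - qj x"
| "qk (- x) = - qk x"

primcorec minus_quat where
  "qr (x - y) = qr x - qr y"
| "qi (x - y) = qi x - qi y"
| "qj (x - y) = qj x - qj y"
| "qk (x - y) = qk x - qk y"

instance
  by standard (simp_all add: quat_eq_iff)

end

instantiation quat :: ring_1
begin

primcorec one_quat where
  "qr 1 = 1" | "qi 1 = 0" | "qj 1 = 0" | "qk 1 = 0"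

text \<open>Multiplication rules $i^2 = j^2 = k^2 = ijk = -1$.\<close>

primcorec times_quat where
  "qr (x * y) = qr x * qr y - qi x * qi y - qj x * qj y - qk x * qk y"
| "qi (x * y) = qr x * qi y + qi x * qr y + qj x * qk y - qk x * qj y"
| "qj (x * y) = qr x * qj y - qi x * qk y + qj x * qr y + qk x * qi y"
| "qk (x * y) = qr x * qk y + qi x * qj y - qj x * qi y + qk x * qr y"

instance
proof
  fix a b c :: quat
  show "a * b * c = a * (b * c)"
    unfolding quat_eq_iff times_quat.sel by (intro conjI; algebra)
  show "(a + b) * c = a * c + b * c" "a * (b + c) = a * b + a * c"
    by (simp_all add: quat_eq_iff algebra_simps)
qed (simp_all add: quat_eq_iff)

end

lemma quat_units:
  defines "i \<equiv> Quat 0 1 0 0" and "j \<equiv> Quat 0 0 1 0" and "k \<equiv> Quat 0 0 0 1"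
  shows "i * i = -1" "j * j = -1" "k * k = -1" "i * j = k" "j * k = i" "k * i = j"
  by (simp_all add: quat_eq_iff i_def j_def k_def)

lemma quat_sum_squares_eq_0_iff:
  "(qr x)\<^sup>2 + (qi x)\<^sup>2 + (qj x)\<^sup>2 + (qk x)\<^sup>2 = 0 \<longleftrightarrow> x = 0"
  by (simp add: quat_eq_iff add_nonneg_eq_0_iff)

instantiation quat :: real_algebra_1
begin

primcorec scaleR_quat where
  "qr (scaleR r x) = r * qr x"
| "qi (scaleR r x) = r * qi x"
| "qj (scaleR r x) = r * qj x"
| "qk (scaleR r x) = r * qk x"

instance
  by standard (simp_all add: quat_eq_iff algebra_simps)

end

instantiation quat :: real_div_algebra
begin

primcorec inverse_quat where
  "qr (inverse x) = qr x / ((qr x)\<^sup>2 + (qi x)\<^sup>2 + (qj x)\<^sup>2 + (qk x)\<^sup>2)"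
| "qi (inverse x) = - qi x / ((qr x)\<^sup>2 + (qi x)\<^sup>2 + (qj x)\<^sup>2 + (qk x)\<^sup>2)"
| "qj (inverse x) = - qj x / ((qr x)\<^sup>2 + (qi x)\<^sup>2 + (qj x)\<^sup>2 + (qk x)\<^sup>2)"
| "qk (inverse x) = - qk x / ((qr x)\<^sup>2 + (qi x)\<^sup>2 + (qj x)\<^sup>2 + (qk x)\<^sup>2)"

definition "x div y = x * inverse y" for x y :: quat

instance
proof
  fix x y :: quat
  show "x div y = x * inverse y"
    by (simp add: divide_quat_def)
  show "inverse (0::quat) = 0"
    by (simp add: quat_eq_iff)
  assume "x \<noteq> 0"
  define s where "s = (qr x)\<^sup>2 + (qi x)\<^sup>2 + (qj x)\<^sup>2 + (qk x)\<^sup>2"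
  have s: "s \<noteq> 0"
    using \<open>x \<noteq> 0\<close> quat_sum_squares_eq_0_iff[of x] by (simp add: s_def)
  have i: "inverse x = Quat (qr x) (- qi x) (- qj x) (- qk x) /\<^sub>R s"
    by (simp add: quat_eq_iff s_def[symmetric] divide_inverse_commute)
  have "Quat (qr x) (- qi x) (- qj x) (- qk x) * x = s *\<^sub>R 1"
    "x * Quat (qr x) (- qi x) (- qj x) (- qk x) = s *\<^sub>R 1"
    by (simp_all add: quat_eq_iff s_def power2_eq_square)
  then show "inverse x * x = 1" "x * inverse x = 1"
    using s by (simp_all add: i)
qed

end

text \<open>The Euclidean structure of $\mathbb{R}^4$.\<close>

instantiation quat :: real_inner
begin

definition inner_quat_def:
  "inner x y = qr x * qr y + qi x * qi y + qj x * qj y + qk x * qk y" for x y :: quat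

definition norm_quat_def:
  "norm x = sqrt ((qr x)\<^sup>2 + (qi x)\<^sup>2 + (qj x)\<^sup>2 + (qk x)\<^sup>2)" for x :: quat

definition sgn_quat_def:
  "sgn x = x /\<^sub>R norm x" for x :: quat

definition dist_quat_def:
  "dist x y = norm (x - y)" for x y :: quat

definition uniformity_quat_def:
  "(uniformity :: (quat \<times> quat) filter) = (INF e\<in>{0 <..}. principal {(x, y). dist x y < e})"

definition open_quat_def:
  "open U \<longleftrightarrow> (\<forall>x\<in>U. eventually (\<lambda>(x', y). x' = x \<longrightarrow> y \<in> U) uniformity)" for U :: "quat set"

instance
proof
  fix x y z :: quat and r :: real and U :: "quat set"
  show "inner x y = inner y x" "inner (x + y) z = inner x z + inner y z"
    "inner (scaleR r x) y = r * inner x y" "0 \<le> inner x x"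
    by (simp_all add: inner_quat_def algebra_simps)
  show "inner x x = 0 \<longleftrightarrow> x = 0"
    using quat_sum_squares_eq_0_iff[of x] by (simp add: inner_quat_def power2_eq_square)
  show "norm x = sqrt (inner x x)"
    by (simp add: norm_quat_def inner_quat_def power2_eq_square)
qed (simp_all add: sgn_quat_def dist_quat_def uniformity_quat_def open_quat_def)

end

instance quat :: real_normed_div_algebra
proof
  fix x y :: quat
  have "(qr (x * y))\<^sup>2 + (qi (x * y))\<^sup>2 + (qj (x * y))\<^sup>2 + (qk (x * y))\<^sup>2 =
    ((qr x)\<^sup>2 + (qi x)\<^sup>2 + (qj x)\<^sup>2 + (qk x)\<^sup>2) *
    ((qr y)\<^sup>2 + (qi y)\<^sup>2 + (qj y)\<^sup>2 + (qk y)\<^sup>2)"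
    unfolding times_quat.sel by algebra
  then show "norm (x * y) = norm x * norm y"
    by (simp only: norm_quat_def real_sqrt_mult)
qed

instantiation quat :: euclidean_space
begin

definition Basis_quat_def:
  "(Basis :: quat set) = {Quat 1 0 0 0, Quat 0 1 0 0, Quat 0 0 1 0, Quat 0 0 0 1}"

instance
proof
  fix u v :: quat
  assume "u \<in> Basis" "v \<in> Basis"
  then show "inner u v = (if u = v then 1 else 0)"
    unfolding Basis_quat_def by (elim insertE emptyE; simp add: inner_quat_def)
next
  fix x :: quat
  show "(\<forall>u\<in>Basis. inner x u = 0) \<longleftrightarrow> x = 0"
    unfolding quat_eq_iff[of x] by (simp add: Basis_quat_def inner_quat_def)
qed (simp_all add: Basis_quat_def)

end


section \<open>Quaternionic polynomials\<close>

text \<open>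
  A polynomial $\sum_k X^k a_k$ is its coefficient sequence, an element of \<^typ>\<open>quat poly\<close>.
  \<^const>\<open>poly\<close> and \<^const>\<open>pderiv\<close> require commutative coefficients, so evaluation (with
  coefficients on the right) and the derivative are defined here.
\<close>

definition qeval :: "quat poly \<Rightarrow> quat \<Rightarrow> quat" where
  "qeval P x = (\<Sum>k\<le>degree P. x ^ k * coeff P k)"

definition qzeros :: "quat poly \<Rightarrow> quat set" where
  "qzeros P = {x. qeval P x = 0}"

definition qderiv :: "quat poly \<Rightarrow> quat poly" where
  "qderiv P = (\<Sum>k = 1..degree P. monom (of_nat k * coeff P k) (k - 1))"

lemma coeff_qderiv: "coeff (qderiv P) n = of_nat (Suc n) * coeff P (Suc n)"
proof -
  have "coeff (qderiv P) n =
      (\<Sum>k = 1..degree P. if k = Suc n then of_nat k * coeff P k else 0)"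
    unfolding qderiv_def coeff_sum by (intro sum.cong) auto
  also have "\<dots> = of_nat (Suc n) * coeff P (Suc n)"
    by (cases "Suc n \<le> degree P") (simp_all add: coeff_eq_0)
  finally show ?thesis .
qed


section \<open>The Gauss--Lucas snail\<close>

definition imaginary_units :: "quat set" where
  "imaginary_units = {I. I\<^sup>2 = -1}"

definition slice :: "quat \<Rightarrow> quat set" where
  "slice I = span {1, I}"

text \<open>
  The hull is taken in the ambient quaternions; as the slice is a subspace, this agrees with the
  hull inside the slice.
\<close>

definition slice_hull :: "quat \<Rightarrow> quat poly \<Rightarrow> quat set" where
  "slice_hull I Q =
     (if qeval Q constant_on slice I then slice I else convex hull (qzeros Q \<inter> slice I))"

definition orth_proj :: "'a::euclidean_space set \<Rightarrow> 'a \<Rightarrow> 'a" where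
  "orth_proj W x = (THE y. y \<in> W \<and> (\<forall>w\<in>W. orthogonal (x - y) w))"

lemma orth_proj_unique:
  assumes "subspace W" "y \<in> W" "\<And>w. w \<in> W \<Longrightarrow> orthogonal (x - y) w"
  shows "orth_proj W x = y"
  unfolding orth_proj_def
proof (rule the_equality)
  fix z assume z: "z \<in> W \<and> (\<forall>w\<in>W. orthogonal (x - z) w)"
  have zy: "z - y \<in> W"
    using assms z by (simp add: subspace_diff)
  have "orthogonal (x - y) (z - y)" "orthogonal (x - z) (z - y)"
    using zy assms z by auto
  then have "inner ((x - y) - (x - z)) (z - y) = 0"
    unfolding orthogonal_def inner_diff_left[of "x - y"] by simp
  then show "z = y" by simp
qed (use assms in auto)

text \<open>\<open>slice_part I P\<close> is $P^I$.\<close>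

definition slice_part :: "quat \<Rightarrow> quat poly \<Rightarrow> quat poly" where
  "slice_part I P = map_poly (orth_proj (slice I)) P"

lemma coeff_slice_part: "coeff (slice_part I P) n = orth_proj (slice I) (coeff P n)"
  unfolding slice_part_def
  by (intro coeff_map_poly orth_proj_unique)
    (simp_all add: slice_def subspace_span span_zero orthogonal_def)

lemma orth_proj_slice:
  assumes "I \<in> imaginary_units"
  shows "orth_proj (slice I) x = inner x 1 *\<^sub>R 1 + inner x I *\<^sub>R I"
proof (rule orth_proj_unique)
  have "I * I = -1"
    using assms by (simp add: imaginary_units_def power2_eq_square)
  then have q: "qr I * qr I - qi I * qi I - qj I * qj I - qk I * qk I = -1"
    "2 * (qr I * qi I) = 0" "2 * (qr I * qj I) = 0" "2 * (qr I * qk I) = 0"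
    by (simp_all add: quat_eq_iff algebra_simps)
  have "qr I = 0"
  proof (rule ccontr)
    assume "qr I \<noteq> 0"
    then have "qi I = 0" "qj I = 0" "qk I = 0" using q by auto
    then show False using q(1) zero_le_square[of "qr I"] by simp
  qed
  then have o: "inner (1::quat) 1 = 1" "inner I 1 = 0" "inner 1 I = 0" "inner I I = 1"
    using q(1) by (simp_all add: inner_quat_def)
  show "subspace (slice I)" by (simp add: slice_def)
  show "inner x 1 *\<^sub>R 1 + inner x I *\<^sub>R I \<in> slice I"
    by (simp add: slice_def span_add span_scale span_base)
  fix w assume "w \<in> slice I"
  then show "orthogonal (x - (inner x 1 *\<^sub>R 1 + inner x I *\<^sub>R I)) w"
    unfolding slice_def
    by (rule orthogonal_to_span)
      (use o in \<open>auto simp: orthogonal_def inner_diff_left inner_add_left\<close>)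
qed

definition snail :: "quat poly \<Rightarrow> quat set" where
  "snail P = (\<Union>I\<in>imaginary_units. slice_hull I (slice_part I P))"

end

theory Submission
  imports Defs "HOL-Computational_Algebra.Fundamental_Theorem_Algebra"
begin

text \<open>
  Let \<open>x\<close> be a zero of $P'$ and choose an imaginary unit \<open>I\<close> with $x \in \mathbb{C}_I$. The
  projection $\pi_I$ commutes with left multiplication by elements of $\mathbb{C}_I$, so
  $(P^I)'(x) = \pi_I(P'(x)) = 0$. On $\mathbb{C}_I \cong \mathbb{C}$, $P^I$ is an ordinary complex
  polynomial, and the classical Gauss--Lucas theorem applies.
\<close>

section \<open>The classical Gauss--Lucas theorem\<close>

text \<open>Logarithmic derivative cleared of denominators: by the product rule each factor
  contributes its own \<open>n a / (z - a)\<close>.\<close>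

lemma poly_pderiv_prod_linear_powers:
  fixes z :: "'a::field_char_0"
  assumes "finite S" "z \<notin> S"
  shows "poly (pderiv (\<Prod>a\<in>S. [:- a, 1:] ^ n a)) z =
    poly (\<Prod>a\<in>S. [:- a, 1:] ^ n a) z * (\<Sum>a\<in>S. of_nat (n a) / (z - a))"
  using assms
proof (induction S rule: finite_induct)
  case (insert b S)
  have "poly (pderiv ([:- b, 1:] ^ n b)) z = (z - b) ^ n b * (of_nat (n b) / (z - b))"
  proof (cases "n b")
    case (Suc m)
    have "poly (pderiv ([:- b, 1:] ^ Suc m)) z = of_nat (Suc m) * (z - b) ^ m"
      unfolding pderiv_power_Suc by (simp add: pderiv_pCons)
    then show ?thesis
      using insert.prems unfolding Suc by simp
  qed (simp add: pderiv_1)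
  with insert show ?case
    by (simp add: pderiv_mult algebra_simps)
qed (simp add: pderiv_1)

text \<open>Away from the roots, a zero of the derivative is a zero of the logarithmic derivative.
  Conjugating that sum turns it into a positive combination of the vectors \<open>z - a\<close>, so
  \<open>z\<close> is a weighted mean of the roots.\<close>

theorem gauss_lucas:
  fixes p :: "complex poly"
  assumes "degree p > 0" and z: "poly (pderiv p) z = 0"
  shows "z \<in> convex hull {a. poly p a = 0}"
proof (cases "poly p z = 0")
  case True
  then show ?thesis by (simp add: hull_inc)
next
  case False
  define S where "S = {a. poly p a = 0}"
  \<comment> \<open>Chosen so that the conjugate of \<open>m / (z - a)\<close>, with
    \<open>m\<close> the multiplicity of \<open>a\<close>, is
    \<open>w a *\<^sub>R (z - a)\<close>.\<close>
  define w where "w a = real (order a p) / (cmod (z - a))\<^sup>2" for a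
  have p0: "p \<noteq> 0" using assms by auto
  have fin: "finite S" using p0 by (simp add: S_def poly_roots_finite)
  have ne: "S \<noteq> {}"
    using fundamental_theorem_of_algebra[of p] assms
    by (auto simp: S_def constant_degree)
  have zS: "z \<notin> S" using False by (simp add: S_def)
  define q where "q = (\<Prod>a\<in>S. [:- a, 1:] ^ order a p)"
  have p_eq: "p = smult (lead_coeff p) q"
    unfolding q_def S_def by (rule complex_poly_decompose[symmetric])
  have "poly p z * (\<Sum>a\<in>S. of_nat (order a p) / (z - a)) = poly (pderiv p) z"
    using poly_pderiv_prod_linear_powers[OF fin zS, of "\<lambda>a. order a p", folded q_def]
    \<comment> \<open>Only the evaluated and the differentiated \<open>p\<close> are factored; the
      multiplicities \<open>order a p\<close> stay as they are.\<close>
    by (subst (1 3) p_eq) (simp add: pderiv_smult)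
  then have "cnj (\<Sum>a\<in>S. of_nat (order a p) / (z - a)) = 0"
    using False z by simp
  also have "cnj (\<Sum>a\<in>S. of_nat (order a p) / (z - a)) = (\<Sum>a\<in>S. w a *\<^sub>R (z - a))"
    unfolding cnj_sum
  proof (rule sum.cong)
    fix a assume "a \<in> S"
    then have "z - a \<noteq> 0" using zS by auto
    then show "cnj (of_nat (order a p) / (z - a)) = w a *\<^sub>R (z - a)"
      using complex_norm_square[of "z - a"]
      by (simp add: w_def scaleR_conv_of_real divide_simps del: right_minus_eq complex_cnj_diff)
  qed simp
  finally have sum_eq: "sum w S *\<^sub>R z = (\<Sum>a\<in>S. w a *\<^sub>R a)"
    by (simp add: scaleR_right_diff_distrib sum_subtractf scaleR_sum_left)
  have wpos: "w a > 0" if "a \<in> S" for a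
    using that zS p0 by (auto simp: w_def S_def order_root intro!: divide_pos_pos)
  have Wpos: "sum w S > 0"
    using fin ne wpos by (intro sum_pos) auto
  \<comment> \<open>Dividing by the total weight makes this a convex combination of the
    roots.\<close>
  have "(\<Sum>a\<in>S. (w a / sum w S) *\<^sub>R a) \<in> convex hull S"
    using Wpos wpos fin
    by (intro convex_sum convex_convex_hull)
       (auto simp: sum_divide_distrib[symmetric] hull_inc less_imp_le)
  also have "(\<Sum>a\<in>S. (w a / sum w S) *\<^sub>R a) = z"
  proof -
    have "(\<Sum>a\<in>S. (w a / sum w S) *\<^sub>R a) = (1 / sum w S) *\<^sub>R (\<Sum>a\<in>S. w a *\<^sub>R a)"
      by (simp add: scaleR_sum_right)
    then show ?thesis using Wpos by (simp flip: sum_eq)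
  qed
  finally show ?thesis by (simp add: S_def)
qed

section \<open>Slices as copies of the complex numbers\<close>

definition slice_embed :: "quat \<Rightarrow> complex \<Rightarrow> quat" where
  "slice_embed I z = Re z *\<^sub>R 1 + Im z *\<^sub>R I"

text \<open>Defined on all quaternions: for an imaginary unit \<open>I\<close> it is the orthogonal
  projection onto the slice, read as a complex number.\<close>

definition slice_coord :: "quat \<Rightarrow> quat \<Rightarrow> complex" where
  "slice_coord I x = Complex (inner x 1) (inner x I)"

lemma linear_slice_embed: "linear (slice_embed I)"
  by (rule linearI) (simp_all add: slice_embed_def algebra_simps)

lemma linear_slice_coord: "linear (slice_coord I)"
  by (rule linearI) (simp_all add: slice_coord_def complex_eq_iff inner_add_left)

lemma slice_coord_0 [simp]: "slice_coord I 0 = 0"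
  by (rule linear_0[OF linear_slice_coord])

lemma slice_embed_1 [simp]: "slice_embed I 1 = 1"
  by (simp add: slice_embed_def)

lemma range_slice_embed: "range (slice_embed I) = slice I"
proof (intro equalityI subsetI)
  fix x assume "x \<in> range (slice_embed I)"
  then show "x \<in> slice I"
    by (auto simp: slice_embed_def slice_def intro!: span_add span_scale intro: span_base)
next
  fix x assume "x \<in> slice I"
  then obtain a b where "x - a *\<^sub>R 1 = b *\<^sub>R I"
    by (auto simp: slice_def span_insert span_singleton)
  then have "x = slice_embed I (Complex a b)"
    by (simp add: slice_embed_def algebra_simps)
  then show "x \<in> range (slice_embed I)" by blast
qed

lemma imaginary_units_iff:
  "I \<in> imaginary_units \<longleftrightarrow> qr I = 0 \<and> (qi I)\<^sup>2 + (qj I)\<^sup>2 + (qk I)\<^sup>2 = 1"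
proof
  assume "I \<in> imaginary_units"
  then have "I * I = -1" by (simp add: imaginary_units_def power2_eq_square)
  then have q: "qr I * qr I - qi I * qi I - qj I * qj I - qk I * qk I = -1"
    "qr I * qi I = 0" "qr I * qj I = 0" "qr I * qk I = 0"
    by (auto simp: quat_eq_iff)
  have "qr I = 0"
  proof (rule ccontr)
    assume "qr I \<noteq> 0"
    with q have "qr I * qr I = -1" by simp
    then show False using zero_le_square[of "qr I"] by linarith
  qed
  with q(1) show "qr I = 0 \<and> (qi I)\<^sup>2 + (qj I)\<^sup>2 + (qk I)\<^sup>2 = 1"
    by (simp add: power2_eq_square)
qed (simp add: imaginary_units_def power2_eq_square quat_eq_iff)

lemma ex_slice: "\<exists>I\<in>imaginary_units. x \<in> slice I"
proof -
  define r where "r = sqrt ((qi x)\<^sup>2 + (qj x)\<^sup>2 + (qk x)\<^sup>2)"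
  have r2: "r\<^sup>2 = (qi x)\<^sup>2 + (qj x)\<^sup>2 + (qk x)\<^sup>2" by (simp add: r_def)
  \<comment> \<open>The normalised imaginary part of \<open>x\<close>. A real \<open>x\<close> lies
    in every slice, so the choice of i for \<open>r = 0\<close> is arbitrary.\<close>
  define I where "I = (if r = 0 then Quat 0 1 0 0 else Quat 0 (qi x / r) (qj x / r) (qk x / r))"
  have "I \<in> imaginary_units"
    by (simp add: imaginary_units_iff I_def power_divide r2[symmetric] flip: add_divide_distrib)
  moreover have "qi x = 0 \<and> qj x = 0 \<and> qk x = 0" if "r = 0"
    using that r2 by (simp add: add_nonneg_eq_0_iff)
  then have "x = slice_embed I (Complex (qr x) r)"
    by (auto simp: slice_embed_def quat_eq_iff I_def)
  then have "x \<in> slice I" using range_slice_embed by blast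
  ultimately show ?thesis by blast
qed

context
  fixes I :: quat
  assumes I: "I \<in> imaginary_units"
begin

lemma imaginary_unit_sq: "I * I = -1"
  using I by (simp add: imaginary_units_def power2_eq_square)

lemma slice_embed_mult: "slice_embed I (z * w) = slice_embed I z * slice_embed I w"
  by (simp add: slice_embed_def algebra_simps imaginary_unit_sq)

lemma slice_embed_power: "slice_embed I (z ^ n) = slice_embed I z ^ n"
  by (induction n) (simp_all add: slice_embed_mult)

lemma orth_proj_slice_eq: "orth_proj (slice I) x = slice_embed I (slice_coord I x)"
  by (simp add: orth_proj_slice[OF I] slice_embed_def slice_coord_def)

lemma slice_coord_embed [simp]: "slice_coord I (slice_embed I z) = z"
proof -
  have "inner I I = 1" "inner 1 I = 0" "inner I 1 = 0" "inner (1::quat) 1 = 1"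
    using I by (simp_all add: imaginary_units_iff inner_quat_def power2_eq_square)
  then show ?thesis
    by (simp add: slice_coord_def slice_embed_def inner_add_left complex_eq_iff)
qed

text \<open>The orthogonal complement of a slice is stable under left multiplication by the slice.\<close>

lemma slice_coord_mult_left: "slice_coord I (slice_embed I z * a) = z * slice_coord I a"
proof -
  have q: "qr I = 0" "(qi I)\<^sup>2 + (qj I)\<^sup>2 + (qk I)\<^sup>2 = 1"
    using I by (simp_all add: imaginary_units_iff)
  \<comment> \<open>By linearity only the factor \<open>I\<close> matters: it sends the coordinates
    (s, t) of \<open>a\<close> to (-t, s), as multiplication by the complex unit does.\<close>
  have "inner (I * a) 1 = - inner a I"
    using q(1) by (simp add: inner_quat_def algebra_simps)
  moreover have "inner (I * a) I = ((qi I)\<^sup>2 + (qj I)\<^sup>2 + (qk I)\<^sup>2) * inner a 1"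
    using q(1) by (simp add: inner_quat_def algebra_simps power2_eq_square)
  then have "inner (I * a) I = inner a 1"
    by (simp add: q(2))
  ultimately show ?thesis
    by (simp add: slice_coord_def slice_embed_def complex_eq_iff algebra_simps inner_add_left)
qed

text \<open>The powers of a point of the slice stand to the left of the coefficients, so the
  projection passes through them.\<close>

lemma slice_coord_qeval:
  "slice_coord I (qeval Q (slice_embed I z)) = poly (map_poly (slice_coord I) Q) z"
proof -
  have "slice_coord I (qeval Q (slice_embed I z)) =
      (\<Sum>k\<le>degree Q. coeff (map_poly (slice_coord I) Q) k * z ^ k)"
    by (simp add: qeval_def linear_sum[OF linear_slice_coord] slice_coord_mult_left
        coeff_map_poly mult.commute flip: slice_embed_power)
  also have "\<dots> = poly (map_poly (slice_coord I) Q) z"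
    unfolding poly_altdef
    \<comment> \<open>Projection may kill leading coefficients, so the degree can drop; the surplus
      terms are zero.\<close>
    by (rule sum.mono_neutral_right) (auto simp: map_poly_degree_leq coeff_eq_0)
  finally show ?thesis .
qed

text \<open>Differentiation scales coefficients by integers, and the projection is real
  linear.\<close>

lemma pderiv_slice_coord: "pderiv (map_poly (slice_coord I) P) = map_poly (slice_coord I) (qderiv P)"
proof (rule poly_eqI)
  fix n
  have "slice_coord I (of_nat m * a) = of_nat m * slice_coord I a" for m a
    using linear_cmul[OF linear_slice_coord, of I "real m" a]
    by (simp add: scaleR_conv_of_real)
  then show "coeff (pderiv (map_poly (slice_coord I) P)) n =
      coeff (map_poly (slice_coord I) (qderiv P)) n"
    by (simp add: coeff_pderiv coeff_map_poly coeff_qderiv del: of_nat_Suc)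
qed

lemma map_poly_slice_coord_slice_part:
  "map_poly (slice_coord I) (slice_part I P) = map_poly (slice_coord I) P"
  by (rule poly_eqI) (simp add: coeff_map_poly coeff_slice_part orth_proj_slice_eq)

text \<open>All coefficients of \<open>slice_part I P\<close> lie in the slice, so its value at a
  point of the slice stays there and is determined by its complex coordinate.\<close>

lemma qeval_slice_part:
  "qeval (slice_part I P) (slice_embed I z) = slice_embed I (poly (map_poly (slice_coord I) P) z)"
proof -
  have "qeval (slice_part I P) (slice_embed I z) =
      slice_embed I (\<Sum>k\<le>degree (slice_part I P). z ^ k * slice_coord I (coeff P k))"
    by (simp add: qeval_def coeff_slice_part orth_proj_slice_eq slice_embed_mult
        slice_embed_power linear_sum[OF linear_slice_embed])
  then show ?thesis
    using slice_coord_qeval[of "slice_part I P" z]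
    by (simp add: map_poly_slice_coord_slice_part)
qed

end

lemma critical_point_in_slice_hull:
  assumes I: "I \<in> imaginary_units" and "qeval (qderiv P) x = 0" "x \<in> slice I"
  shows "x \<in> slice_hull I (slice_part I P)"
proof (cases "qeval (slice_part I P) constant_on slice I")
  case True
  then show ?thesis using assms by (simp add: slice_hull_def)
next
  case False
  define p where "p = map_poly (slice_coord I) P"
  obtain z where x: "x = slice_embed I z"
    using assms range_slice_embed by blast
  have ev: "qeval (slice_part I P) (slice_embed I w) = slice_embed I (poly p w)" for w
    unfolding p_def by (rule qeval_slice_part[OF I])
  \<comment> \<open>A constant \<open>p\<close> would make \<open>slice_part I P\<close> constant on
    the slice, the case already settled.\<close>
  have "degree p > 0"
  proof (rule ccontr)
    assume "\<not> degree p > 0"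
    then obtain c where "p = [:c:]" by (auto elim: degree_eq_zeroE)
    then have "qeval (slice_part I P) constant_on slice I"
      unfolding constant_on_def range_slice_embed[symmetric] using ev by auto
    with False show False by contradiction
  qed
  \<comment> \<open>The left side is the coordinate of the value of \<open>qderiv P\<close> at
    \<open>x\<close>, which is zero.\<close>
  moreover have "poly (pderiv p) z = 0"
    using slice_coord_qeval[OF I, of "qderiv P" z] assms x
    by (simp add: p_def pderiv_slice_coord[OF I])
  ultimately have "z \<in> convex hull {a. poly p a = 0}" by (rule gauss_lucas)
  \<comment> \<open>A linear map carries convex hulls to convex hulls, and
    \<open>slice_embed I\<close> carries roots of \<open>p\<close> to zeros of
    \<open>slice_part I P\<close>.\<close>
  then have "x \<in> convex hull (slice_embed I ` {a. poly p a = 0})"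
    using convex_hull_linear_image[OF linear_slice_embed] x by blast
  also have "slice_embed I ` {a. poly p a = 0} \<subseteq> qzeros (slice_part I P) \<inter> slice I"
    using range_slice_embed[of I] ev linear_0[OF linear_slice_embed] by (auto simp: qzeros_def)
  then have "convex hull (slice_embed I ` {a. poly p a = 0}) \<subseteq>
      convex hull (qzeros (slice_part I P) \<inter> slice I)"
    by (rule hull_mono)
  finally show ?thesis using False by (simp add: slice_hull_def)
qed

theorem theorem8:
  fixes P :: "quat poly"
  assumes "degree P \<ge> 2"
  shows "qzeros (qderiv P) \<subseteq> snail P"
  using ex_slice critical_point_in_slice_hull
  by (fastforce simp: snail_def qzeros_def)

end
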